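(* Let $A$ be a forest automaton and let $\varphi$ be a live execution property for $A$. Then there exists a set $L$ of complemented pairs over $A$ such that $(A,L)$ is a live automaton and $\mathit{lexecs}(A,L)=\varphi$.
   Context: An automaton $A$ has a set of states $\mathit{states}(A)$, nonempty start states, actions, and a transition relation $\mathit{steps}(A)\subseteq\mathit{states}(A)\times\mathit{acts}(A)\times\mathit{states}(A)$. An execution is a finite or infinite alternating sequence $s_0a_1s_1\ldots$ starting in a start state with each $(s_i,a_{i+1},s_{i+1})\in\mathit{steps}(A)$ (ending in a state if finite); $\alpha<\alpha'$ means proper prefix; $\mathit{execs}^\omega(A)$ is the set of infinite executions. $A$ is a forest automaton if for each reachable state $s$ there is exactly one finite execution of $A$ whose last state is $s$. A live execution property is a set $\varphi\subseteq\mathit{execs}^\omega(A)$ such that every finite execution has a proper extension in $\varphi$. A complemented pair is $p=\langle p.\mathsf{R},p.\mathsf{G}\rangle$ with $p.\mathsf{R},p.\mathsf{G}\subseteq\mathit{states}(A)$; an infinite execution $\alpha$ satisfies $p$ ($\alpha\models p$) iff, if infinitely many positions of $\alpha$ carry states in $p.\mathsf{R}$, then infinitely many carry states in $p.\mathsf{G}$. $(A,L)$ is a live automaton if $L$ is a set (any cardinality) of complemented pairs such that each finite execution has a proper infinite extension execution satisfying all pairs of $L$; $\mathit{lexecs}(A,L)=\{\alpha\in\mathit{execs}^\omega(A)\mid\forall p\in L:\alpha\models p\}$. *)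

theory Defs
  imports Main
begin

record ('s, 'a) automaton =
  states :: "'s set"
  start :: "'s set"
  acts :: "'a set"
  steps :: "('s \<times> 'a \<times> 's) set"

definition is_automaton :: "('s, 'a) automaton \<Rightarrow> bool" where
  "is_automaton A \<longleftrightarrow>
     start A \<noteq> {} \<and> start A \<subseteq> states A \<and> steps A \<subseteq> states A \<times> acts A \<times> states A"

text \<open>
  A finite alternating sequence \<open>s\<^sub>0 a\<^sub>1 s\<^sub>1 \<dots> a\<^sub>n s\<^sub>n\<close> is the pair of \<open>s\<^sub>0\<close> and the list
  \<open>[(a\<^sub>1, s\<^sub>1), \<dots>, (a\<^sub>n, s\<^sub>n)]\<close>. An infinite one is a pair \<open>(s, a)\<close> of functions where
  \<open>s i\<close> is the state \<open>s\<^sub>i\<close> and \<open>a i\<close> is the action \<open>a\<^bsub>i+1\<^esub>\<close> between \<open>s\<^sub>i\<close> and \<open>s\<^bsub>i+1\<^esub>\<close>.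
\<close>

type_synonym ('s, 'a) fin_seq = "'s \<times> ('a \<times> 's) list"
type_synonym ('s, 'a) inf_seq = "(nat \<Rightarrow> 's) \<times> (nat \<Rightarrow> 'a)"

definition fin_states :: "('s, 'a) fin_seq \<Rightarrow> 's list" where
  "fin_states \<alpha> = fst \<alpha> # map snd (snd \<alpha>)"

definition last_state :: "('s, 'a) fin_seq \<Rightarrow> 's" where
  "last_state \<alpha> = last (fin_states \<alpha>)"

definition execs_fin :: "('s, 'a) automaton \<Rightarrow> ('s, 'a) fin_seq set" where
  "execs_fin A = {\<alpha>. fst \<alpha> \<in> start A \<and>
     (\<forall>i < length (snd \<alpha>).
        (fin_states \<alpha> ! i, fst (snd \<alpha> ! i), fin_states \<alpha> ! Suc i) \<in> steps A)}"

definition execs_inf :: "('s, 'a) automaton \<Rightarrow> ('s, 'a) inf_seq set" where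
  "execs_inf A = {\<alpha>. fst \<alpha> 0 \<in> start A \<and>
     (\<forall>i. (fst \<alpha> i, snd \<alpha> i, fst \<alpha> (Suc i)) \<in> steps A)}"

text \<open>
  The prefix relation is only needed between a finite and an infinite sequence, where every
  prefix is automatically a proper one.
\<close>

definition proper_prefix :: "('s, 'a) fin_seq \<Rightarrow> ('s, 'a) inf_seq \<Rightarrow> bool" where
  "proper_prefix \<alpha> \<alpha>' \<longleftrightarrow>
     fst \<alpha> = fst \<alpha>' 0 \<and>
     (\<forall>i < length (snd \<alpha>). snd \<alpha> ! i = (snd \<alpha>' i, fst \<alpha>' (Suc i)))"

definition reachable :: "('s, 'a) automaton \<Rightarrow> 's \<Rightarrow> bool" where
  "reachable A s \<longleftrightarrow> (\<exists>\<alpha> \<in> execs_fin A. last_state \<alpha> = s)"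

definition forest_automaton :: "('s, 'a) automaton \<Rightarrow> bool" where
  "forest_automaton A \<longleftrightarrow> is_automaton A \<and>
     (\<forall>s. reachable A s \<longrightarrow> (\<exists>!\<alpha>. \<alpha> \<in> execs_fin A \<and> last_state \<alpha> = s))"

definition live_execution_property ::
    "('s, 'a) automaton \<Rightarrow> ('s, 'a) inf_seq set \<Rightarrow> bool" where
  "live_execution_property A \<phi> \<longleftrightarrow> \<phi> \<subseteq> execs_inf A \<and>
     (\<forall>\<alpha> \<in> execs_fin A. \<exists>\<alpha>' \<in> \<phi>. proper_prefix \<alpha> \<alpha>')"

record 's complemented_pair =
  Rset :: "'s set"
  Gset :: "'s set"

definition complemented_pairs :: "('s, 'a) automaton \<Rightarrow> 's complemented_pair set" where
  "complemented_pairs A = {p. Rset p \<subseteq> states A \<and> Gset p \<subseteq> states A}"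

definition satisfies :: "('s, 'a) inf_seq \<Rightarrow> 's complemented_pair \<Rightarrow> bool"
    (infix "\<Turnstile>" 50) where
  "\<alpha> \<Turnstile> p \<longleftrightarrow>
     (infinite {i. fst \<alpha> i \<in> Rset p} \<longrightarrow> infinite {i. fst \<alpha> i \<in> Gset p})"

definition live_automaton ::
    "('s, 'a) automaton \<Rightarrow> 's complemented_pair set \<Rightarrow> bool" where
  "live_automaton A L \<longleftrightarrow> is_automaton A \<and> L \<subseteq> complemented_pairs A \<and>
     (\<forall>\<alpha> \<in> execs_fin A. \<exists>\<alpha>' \<in> execs_inf A. proper_prefix \<alpha> \<alpha>' \<and> (\<forall>p \<in> L. \<alpha>' \<Turnstile> p))"

definition lexecs ::
    "('s, 'a) automaton \<Rightarrow> 's complemented_pair set \<Rightarrow> ('s, 'a) inf_seq set" where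
  "lexecs A L = {\<alpha> \<in> execs_inf A. \<forall>p \<in> L. \<alpha> \<Turnstile> p}"

end

theory Submission imports Defs begin

text \<open>
  Every infinite execution \<open>\<alpha>\<close> outside \<open>\<phi>\<close> is excluded by the pair whose \<open>R\<close> is the set of states
  of \<open>\<alpha>\<close> and whose \<open>G\<close> is empty. In a forest automaton a state determines the finite execution
  leading to it, so an infinite execution meeting the states of \<open>\<alpha>\<close> infinitely often shares
  arbitrarily long prefixes with \<open>\<alpha>\<close> and hence equals \<open>\<alpha>\<close>. Thus the pair excludes \<open>\<alpha>\<close> only.
\<close>

definition fin_prefix :: "('s, 'a) inf_seq \<Rightarrow> nat \<Rightarrow> ('s, 'a) fin_seq" where
  "fin_prefix \<alpha> n = (fst \<alpha> 0, map (\<lambda>i. (snd \<alpha> i, fst \<alpha> (Suc i))) [0..<n])"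

lemma fin_states_fin_prefix: "fin_states (fin_prefix \<alpha> n) = map (fst \<alpha>) [0..<Suc n]"
  by (simp add: fin_states_def fin_prefix_def comp_def map_upt_Suc del: upt_Suc)

lemma last_state_fin_prefix: "last_state (fin_prefix \<alpha> n) = fst \<alpha> n"
  by (simp add: last_state_def fin_states_fin_prefix)

lemma fin_prefix_in_execs_fin:
  assumes "\<alpha> \<in> execs_inf A"
  shows "fin_prefix \<alpha> n \<in> execs_fin A"
proof -
  have "fin_states (fin_prefix \<alpha> n) ! i = fst \<alpha> i" if "i \<le> n" for i
    using that by (simp add: fin_states_fin_prefix nth_append)
  with assms show ?thesis
    by (simp add: execs_fin_def execs_inf_def fin_prefix_def)
qed

text \<open>The bound is strict because the action at index \<open>m\<close> lies beyond a prefix of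
  length \<open>m\<close>.\<close>

lemma fin_prefix_eqD:
  assumes "fin_prefix \<alpha> m = fin_prefix \<beta> n"
  shows "m = n" and "i < m \<Longrightarrow> fst \<alpha> i = fst \<beta> i" and "i < m \<Longrightarrow> snd \<alpha> i = snd \<beta> i"
proof -
  show mn: "m = n"
    using arg_cong[OF assms, of "length \<circ> snd"] by (simp add: fin_prefix_def)
  show "snd \<alpha> i = snd \<beta> i" if "i < m"
    using that assms mn by (auto simp: fin_prefix_def)
  show "fst \<alpha> i = fst \<beta> i" if "i < m"
    \<comment> \<open>The initial state is stored apart from the list; state \<open>Suc j\<close>
      sits in list entry \<open>j\<close>.\<close>
    using that assms mn by (cases i) (auto simp: fin_prefix_def)
qed

text \<open>Both prefixes are finite executions ending in the same state, so uniqueness in a forest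
  identifies them. This also forces \<open>m = n\<close>, which is not assumed.\<close>

lemma forest_automaton_fin_prefix_eq:
  assumes "forest_automaton A" and "\<alpha> \<in> execs_inf A" and "\<beta> \<in> execs_inf A"
    and "fst \<alpha> m = fst \<beta> n"
  shows "fin_prefix \<alpha> m = fin_prefix \<beta> n"
proof -
  have "reachable A (fst \<alpha> m)"
    unfolding reachable_def
    using fin_prefix_in_execs_fin[OF assms(2)] last_state_fin_prefix by blast
  then show ?thesis
    using assms fin_prefix_in_execs_fin last_state_fin_prefix
    unfolding forest_automaton_def by metis
qed

lemma forest_automaton_execs_inf_eqI:
  assumes "forest_automaton A" and "\<alpha> \<in> execs_inf A" and "\<beta> \<in> execs_inf A"
    and inf: "infinite {i. fst \<beta> i \<in> range (fst \<alpha>)}"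
  shows "\<beta> = \<alpha>"
proof -
  have "fst \<beta> k = fst \<alpha> k \<and> snd \<beta> k = snd \<alpha> k" for k
  proof -
    \<comment> \<open>An infinite set of positions has a member beyond \<open>k\<close>; the prefix
      up to it contains both the state and the action at \<open>k\<close>.\<close>
    have "\<not> {i. fst \<beta> i \<in> range (fst \<alpha>)} \<subseteq> {..k}"
      using inf finite_subset by blast
    then obtain i where "i \<in> {i. fst \<beta> i \<in> range (fst \<alpha>)}" and "i \<notin> {..k}"
      by (meson subsetI)
    then obtain j where "k < i" and "fst \<beta> i = fst \<alpha> j"
      by auto
    then show ?thesis
      using fin_prefix_eqD(2,3)[OF forest_automaton_fin_prefix_eq[OF assms(1,3,2)]] by simp
  qed
  then show ?thesis by (simp add: prod_eq_iff fun_eq_iff)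
qed

definition excluding_pair :: "('s, 'a) inf_seq \<Rightarrow> 's complemented_pair" where
  "excluding_pair \<alpha> = \<lparr>Rset = range (fst \<alpha>), Gset = {}\<rparr>"

text \<open>\<open>\<alpha>\<close> itself visits \<open>Rset\<close> at every position and the
  empty \<open>Gset\<close> never, so it fails the pair. Any other execution visits
  \<open>Rset\<close> only finitely often and satisfies it vacuously.\<close>

lemma satisfies_excluding_pair_iff:
  assumes "forest_automaton A" and "\<alpha> \<in> execs_inf A" and "\<beta> \<in> execs_inf A"
  shows "\<beta> \<Turnstile> excluding_pair \<alpha> \<longleftrightarrow> \<beta> \<noteq> \<alpha>"
  using forest_automaton_execs_inf_eqI[OF assms]
  by (auto simp: satisfies_def excluding_pair_def)

lemma excluding_pair_in_complemented_pairs: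
  assumes "is_automaton A" and "\<alpha> \<in> execs_inf A"
  shows "excluding_pair \<alpha> \<in> complemented_pairs A"
  using assms
  by (fastforce simp: is_automaton_def execs_inf_def complemented_pairs_def excluding_pair_def)

theorem theorem17:
  fixes A :: "('s, 'a) automaton" and \<phi> :: "('s, 'a) inf_seq set"
  assumes "forest_automaton A"
    and "live_execution_property A \<phi>"
  shows "\<exists>L \<subseteq> complemented_pairs A. live_automaton A L \<and> lexecs A L = \<phi>"
proof -
  define L where "L = excluding_pair ` (execs_inf A - \<phi>)"
  have aut: "is_automaton A"
    using assms(1) by (simp add: forest_automaton_def)
  have sub: "L \<subseteq> complemented_pairs A"
    unfolding L_def using excluding_pair_in_complemented_pairs[OF aut] by blast
  have "\<phi> \<subseteq> execs_inf A"
    using assms(2) by (simp add: live_execution_property_def)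
  then have lexecs: "lexecs A L = \<phi>"
    unfolding lexecs_def L_def using satisfies_excluding_pair_iff[OF assms(1)] by blast
  have "live_automaton A L"
    unfolding live_automaton_def
  proof (intro conjI ballI)
    fix \<alpha> assume "\<alpha> \<in> execs_fin A"
    then obtain \<alpha>' where "\<alpha>' \<in> \<phi>" and "proper_prefix \<alpha> \<alpha>'"
      using assms(2) unfolding live_execution_property_def by blast
    \<comment> \<open>The extension in \<open>\<phi>\<close> satisfies all of \<open>L\<close>
      because \<open>\<phi>\<close> equals \<open>lexecs A L\<close>.\<close>
    then show "\<exists>\<alpha>' \<in> execs_inf A. proper_prefix \<alpha> \<alpha>' \<and> (\<forall>p \<in> L. \<alpha>' \<Turnstile> p)"
      using lexecs unfolding lexecs_def by blast
  qed (fact aut sub)+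
  with sub lexecs show ?thesis by blast
qed

end
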